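(* Let $M\in\mathbb{R}^{n\times n}$ be RDD or CDD and let $b\in\operatorname{range}(M)$. Define $$x^{\ast}:=\frac12\sum_{\ell=0}^{\infty}\Big(\tfrac12\big(I+D_M^{-1}A_M^{\top}\big)\Big)^{\ell}D_M^{-1}b .$$ Then $x^{\ast}$ is well-defined (the series converges) and $Mx^{\ast}=b$. Moreover, if $M$ is SDD, then $x^{\ast}=D_M^{-1/2}\widetilde M^{+}D_M^{-1/2}b$, where $\widetilde M:=D_M^{-1/2}MD_M^{-1/2}$ and $^{+}$ denotes the Moore–Penrose pseudoinverse.
   Context: A matrix $M\in\mathbb{R}^{n\times n}$ is RDD (row diagonally dominant) if all its diagonal entries are positive and $M(j,j)\ge\sum_{k\ne j}|M(j,k)|$ for all $j$; it is CDD if $M^{\top}$ is RDD; it is SDD if it is symmetric and RDD. Write $M=D_M-A_M^{\top}$ uniquely, where $D_M$ is the diagonal matrix with $D_M(k,k)=M(k,k)$ and $A_M^{\top}$ has zero diagonal. *)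

theory Defs
  imports "HOL-Analysis.Analysis"
begin

definition RDD :: "real^'n^'n \<Rightarrow> bool" where
  "RDD M \<longleftrightarrow> (\<forall>j. M $ j $ j > 0) \<and> (\<forall>j. M $ j $ j \<ge> (\<Sum>k\<in>UNIV - {j}. \<bar>M $ j $ k\<bar>))"

definition CDD :: "real^'n^'n \<Rightarrow> bool" where
  "CDD M \<longleftrightarrow> RDD (transpose M)"

definition SDD :: "real^'n^'n \<Rightarrow> bool" where
  "SDD M \<longleftrightarrow> transpose M = M \<and> RDD M"

definition diag_part :: "real^'n^'n \<Rightarrow> real^'n^'n" where
  "diag_part M = (\<chi> i j. if i = j then M $ i $ i else 0)"

definition adj_part :: "real^'n^'n \<Rightarrow> real^'n^'n" where
  "adj_part M = transpose (diag_part M - M)"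

text \<open>\<open>D = diag_part M\<close> and \<open>A = adj_part M\<close> are the unique matrices with
  \<open>M = D - A\<^sup>T\<close>, \<open>D\<close> diagonal and \<open>A\<^sup>T\<close> of zero diagonal:\<close>

lemma diag_adj_decomposition:
  "M = D - transpose A \<and> (\<forall>i j. i \<noteq> j \<longrightarrow> D $ i $ j = 0) \<and> (\<forall>i. transpose A $ i $ i = 0)
    \<longleftrightarrow> D = diag_part M \<and> A = adj_part M"
proof
  assume h: "M = D - transpose A \<and> (\<forall>i j. i \<noteq> j \<longrightarrow> D $ i $ j = 0) \<and> (\<forall>i. transpose A $ i $ i = 0)"
  then have D: "D = diag_part M"
    by (auto simp: vec_eq_iff diag_part_def)
  have "transpose A = D - M"
    using h by simp
  then have "A = transpose (D - M)"
    by (metis transpose_transpose)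
  then show "D = diag_part M \<and> A = adj_part M"
    using D by (simp add: adj_part_def)
qed (auto simp: adj_part_def diag_part_def)

text \<open>The library's \<open>(*)\<close> and \<open>(^)\<close> on \<open>real^'n^'n\<close> are componentwise,
  so powers with respect to the matrix product need their own definition.\<close>

primrec matrix_pow :: "real^'n^'n \<Rightarrow> nat \<Rightarrow> real^'n^'n" where
  "matrix_pow A 0 = mat 1"
| "matrix_pow A (Suc l) = A ** matrix_pow A l"

text \<open>\<open>D\<^sup>-\<^sup>1\<^sup>/\<^sup>2\<close> for a diagonal matrix \<open>D\<close> with positive diagonal.\<close>

definition diag_inv_sqrt :: "real^'n^'n \<Rightarrow> real^'n^'n" where
  "diag_inv_sqrt D = (\<chi> i j. if i = j then 1 / sqrt (D $ i $ i) else 0)"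

text \<open>The four Penrose conditions, for real matrices.\<close>

definition is_pseudoinverse :: "real^'n^'m \<Rightarrow> real^'m^'n \<Rightarrow> bool" where
  "is_pseudoinverse A X \<longleftrightarrow>
     A ** X ** A = A \<and> X ** A ** X = X \<and>
     transpose (A ** X) = A ** X \<and> transpose (X ** A) = X ** A"

lemma is_pseudoinverse_unique:
  assumes "is_pseudoinverse A X" and "is_pseudoinverse A Y"
  shows "X = Y"
proof -
  have X: "A ** X ** A = A" "X ** A ** X = X" "transpose (A ** X) = A ** X" "transpose (X ** A) = X ** A"
    and Y: "A ** Y ** A = A" "Y ** A ** Y = Y" "transpose (A ** Y) = A ** Y" "transpose (Y ** A) = Y ** A"
    using assms by (auto simp: is_pseudoinverse_def)
  have "A ** X = transpose ((A ** Y) ** (A ** X))"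
    by (metis X(3) Y(1) matrix_mul_assoc)
  also have "\<dots> = (A ** X) ** (A ** Y)"
    by (subst matrix_transpose_mul) (simp only: X Y)
  also have "\<dots> = A ** Y"
    by (metis X(1) matrix_mul_assoc)
  finally have AX: "A ** X = A ** Y" .
  have "X ** A = transpose ((X ** A) ** (Y ** A))"
    by (metis X(4) Y(1) matrix_mul_assoc)
  also have "\<dots> = (Y ** A) ** (X ** A)"
    by (subst matrix_transpose_mul) (simp only: X Y)
  also have "\<dots> = Y ** A"
    by (metis X(1) matrix_mul_assoc)
  finally have XA: "X ** A = Y ** A" .
  show ?thesis
    by (metis AX XA X(2) Y(2) matrix_mul_assoc)
qed

definition pseudoinverse :: "real^'n^'m \<Rightarrow> real^'m^'n" where
  "pseudoinverse A = (THE X. is_pseudoinverse A X)"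

definition xstar_term :: "real^'n^'n \<Rightarrow> real^'n \<Rightarrow> nat \<Rightarrow> real^'n" where
  "xstar_term M b l =
     matrix_pow ((1/2) *\<^sub>R (mat 1 + matrix_inv (diag_part M) ** transpose (adj_part M))) l
       *v (matrix_inv (diag_part M) *v b)"

definition xstar :: "real^'n^'n \<Rightarrow> real^'n \<Rightarrow> real^'n" where
  "xstar M b = (1/2) *\<^sub>R (\<Sum>l. xstar_term M b l)"

definition normalized :: "real^'n^'n \<Rightarrow> real^'n^'n" where
  "normalized M = diag_inv_sqrt (diag_part M) ** M ** diag_inv_sqrt (diag_part M)"

end

theory Submission
  imports Defs
begin

text \<open>Write \<open>J = D\<^sup>-\<^sup>1A\<^sup>T = 1 - D\<^sup>-\<^sup>1M\<close> and \<open>W = (1 + J)/2\<close>. If \<open>b = My\<close>, then \<open>D\<^sup>-\<^sup>1b = 2(1 - W)y\<close>, so the series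
  telescopes and \<open>x\<^sup>* = y - lim W\<^sup>n y\<close>; the limit is fixed by \<open>W\<close>, i.e. lies in the kernel of \<open>M\<close>.
  It remains to see that \<open>W\<^sup>n\<close> converges. In the RDD case \<open>J\<close> does not increase the maximum norm,
  and averaging with the identity means that an entry of \<open>Wv\<close> can only have the absolute value
  \<open>\<parallel>v\<parallel>\<close> if it equals the same entry of \<open>v\<close>; a compactness argument finishes. The CDD case follows
  by transposing and conjugating with \<open>D\<close>. In the SDD case, \<open>D\<^sup>1\<^sup>/\<^sup>2 W D\<^sup>-\<^sup>1\<^sup>/\<^sup>2\<close> is symmetric, and its powers
  converge to the orthogonal projection onto the kernel of the normalized matrix.\<close>

section \<open>Matrix powers, and limits of matrix-valued sequences\<close>

lemma matrix_pow_commute: "matrix_pow A n ** A = A ** matrix_pow A n"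
  by (induction n) (simp_all add: matrix_mul_assoc[symmetric])

lemma matrix_pow_intertwine:
  assumes "A ** S = S ** B"
  shows "matrix_pow A n ** S = S ** matrix_pow B n"
  by (induction n) (simp, metis assms matrix_mul_assoc matrix_pow.simps(2))

lemma transpose_matrix_pow: "transpose (matrix_pow A n) = matrix_pow (transpose A) n"
  by (induction n) (simp_all add: matrix_transpose_mul matrix_pow_commute)

lemma matrix_pow_fixed: "A *v x = x \<Longrightarrow> matrix_pow A n *v x = x"
  by (induction n) (simp_all add: matrix_vector_mul_assoc[symmetric])

lemma tendsto_matrix_mult:
  fixes f :: "'a \<Rightarrow> real^'m^'n" and g :: "'a \<Rightarrow> real^'k^'m"
  assumes "(f \<longlongrightarrow> A) F" "(g \<longlongrightarrow> B) F"
  shows "((\<lambda>x. f x ** g x) \<longlongrightarrow> A ** B) F"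
  unfolding matrix_matrix_mult_def by (intro tendsto_intros assms)

lemma tendsto_matrix_vector_mult:
  fixes f :: "'a \<Rightarrow> real^'m^'n"
  assumes "(f \<longlongrightarrow> A) F"
  shows "((\<lambda>x. f x *v v) \<longlongrightarrow> A *v v) F"
  unfolding matrix_vector_mult_def by (intro tendsto_intros assms)

lemma tendsto_transpose:
  fixes f :: "'a \<Rightarrow> real^'m^'n"
  assumes "(f \<longlongrightarrow> A) F"
  shows "((\<lambda>x. transpose (f x)) \<longlongrightarrow> transpose A) F"
  unfolding transpose_def by (intro tendsto_intros assms)

text \<open>The columns of \<open>X n\<close> are the images of the standard basis vectors.
  Convergence of the powers thus reduces to that of single orbits.\<close>

lemma convergent_matrix_if_mult_vector:
  fixes X :: "nat \<Rightarrow> real^'m^'n"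
  assumes "\<And>v. convergent (\<lambda>n. X n *v v)"
  shows "convergent X"
proof -
  have "\<exists>c. (\<lambda>n. X n $ i $ j) \<longlonglongrightarrow> c" for i j
  proof -
    obtain c where "(\<lambda>n. X n *v axis j 1) \<longlonglongrightarrow> c"
      using assms by (auto simp: convergent_def)
    then have "(\<lambda>n. (X n *v axis j 1) $ i) \<longlonglongrightarrow> c $ i"
      by (rule tendsto_vec_nth)
    then show ?thesis
      by (auto simp: matrix_vector_mult_basis column_def)
  qed
  then obtain c where "\<And>i j. (\<lambda>n. X n $ i $ j) \<longlonglongrightarrow> c i j"
    by metis
  then have "X \<longlonglongrightarrow> (\<chi> i j. c i j)"
    by (intro vec_tendstoI) simp
  then show ?thesis
    by (auto simp: convergent_def)
qed

section \<open>Maximum norm and averaging with the identity\<close>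

lemma infnorm_le_cart:
  fixes x :: "real^'n"
  assumes "\<And>i. \<bar>x $ i\<bar> \<le> c"
  shows "infnorm x \<le> c"
  unfolding infnorm_cart by (rule cSup_least) (use assms in auto)

lemma infnorm_attained_cart:
  fixes x :: "real^'n"
  obtains i where "\<bar>x $ i\<bar> = infnorm x"
proof -
  have "infnorm x \<in> (\<lambda>i. \<bar>x \<bullet> i\<bar>) ` Basis"
    unfolding infnorm_Max by (rule Max_in) auto
  then show ?thesis
    using that by (auto simp: Basis_vec_def inner_axis)
qed

text \<open>Named after lazy random walks, which stay put with probability 1/2.\<close>

definition lazy :: "real^'n^'n \<Rightarrow> real^'n^'n" where
  "lazy A = (1/2) *\<^sub>R (mat 1 + A)"

lemma lazy_mult_vector: "lazy A *v v = (1/2) *\<^sub>R (v + A *v v)"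
  by (simp add: lazy_def scaleR_matrix_vector_assoc[symmetric] matrix_vector_mult_add_rdistrib)

lemma transpose_lazy: "transpose (lazy A) = lazy (transpose A)"
  by (simp add: lazy_def transpose_def mat_def vec_eq_iff)

lemma lazy_intertwine:
  assumes "A ** S = S ** B"
  shows "lazy A ** S = S ** lazy B"
proof -
  have "A *v (S *v x) = S *v (B *v x)" for x
    by (simp add: matrix_vector_mul_assoc assms)
  then show ?thesis
    by (simp add: matrix_eq matrix_vector_mul_assoc[symmetric] lazy_mult_vector algebra_simps)
qed

section \<open>Convergence for matrices that do not increase the maximum norm\<close>

context
  fixes A :: "real^'n^'n"
  assumes row_sum: "\<And>i. (\<Sum>j\<in>UNIV. \<bar>A $ i $ j\<bar>) \<le> 1"
begin

lemma row_bound: "\<bar>(A *v v) $ i\<bar> \<le> infnorm v"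
proof -
  have "\<bar>(A *v v) $ i\<bar> \<le> (\<Sum>j\<in>UNIV. \<bar>A $ i $ j\<bar> * \<bar>v $ j\<bar>)"
    by (simp add: matrix_vector_mult_def abs_mult[symmetric])
  also have "\<dots> \<le> (\<Sum>j\<in>UNIV. \<bar>A $ i $ j\<bar> * infnorm v)"
    by (intro sum_mono mult_left_mono component_le_infnorm_cart) simp
  also have "\<dots> \<le> infnorm v"
    using mult_right_mono[OF row_sum infnorm_pos_le] by (simp add: sum_distrib_right)
  finally show ?thesis .
qed

lemma infnorm_lazy_le: "infnorm (lazy A *v v) \<le> infnorm v"
proof (rule infnorm_le_cart)
  fix i
  show "\<bar>(lazy A *v v) $ i\<bar> \<le> infnorm v"
    using row_bound[of v i] component_le_infnorm_cart[of v i] by (simp add: lazy_mult_vector)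
qed

text \<open>The mean of two numbers in [-c, c] has absolute value c only if both are the same
  endpoint.\<close>

lemma lazy_fixes_extremal_entry:
  assumes "\<bar>(lazy A *v v) $ i\<bar> = infnorm v"
  shows "(lazy A *v v) $ i = v $ i"
  using assms row_bound[of v i] component_le_infnorm_cart[of v i] by (simp add: lazy_mult_vector)

text \<open>An entry of the increment that is extremal (of absolute value \<open>c\<close>) at time \<open>m\<close> was constant
  up to then, so that entry of the orbit moved by \<open>m c\<close>; but the orbit is bounded.\<close>

lemma lazy_fixed_if_infnorm_increment_const:
  assumes const: "\<And>m. infnorm (matrix_pow (lazy A) m *v (a - lazy A *v a)) = c"
  shows "lazy A *v a = a"
proof -
  define p where "p m = matrix_pow (lazy A) m *v a" for m
  have p_Suc: "p (Suc m) = lazy A *v p m" for m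
    by (simp add: p_def matrix_vector_mul_assoc)
  have p_bound: "infnorm (p m) \<le> infnorm a" for m
  proof (induction m)
    case (Suc m)
    then show ?case
      using infnorm_lazy_le[of "p m"] by (simp add: p_Suc)
  qed (simp add: p_def)
  define d where "d m = p m - p (Suc m)" for m
  have d_Suc: "d (Suc m) = lazy A *v d m" for m
    by (simp add: d_def p_Suc matrix_vector_mult_diff_distrib)
  have d_eq: "d m = matrix_pow (lazy A) m *v (a - lazy A *v a)" for m
    by (induction m) (simp add: d_def p_def, simp add: d_Suc matrix_vector_mul_assoc)
  then have d_norm: "infnorm (d m) = c" for m
    using const by simp
  have "real m * c \<le> 2 * infnorm a" for m
  proof -
    obtain i where i: "\<bar>d m $ i\<bar> = c"
      using infnorm_attained_cart d_norm by metis
    \<comment> \<open>Going backwards: the extremal entry at one time is an entry of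
      \<open>lazy A\<close> applied to the previous increment, which has the same norm
      \<open>c\<close>. For \<open>k\<close> beyond \<open>m\<close>, truncated subtraction keeps
      the time at 0.\<close>
    have const_up_to: "d (m - k) $ i = d m $ i" for k
    proof (induction k)
      case (Suc k)
      show ?case
      proof (cases "k < m")
        case True
        then have "d (m - k) = lazy A *v d (m - Suc k)"
          by (metis Suc_diff_Suc d_Suc)
        then show ?thesis
          using lazy_fixes_extremal_entry[of "d (m - Suc k)" i] Suc i d_norm by simp
      next
        case False
        then show ?thesis
          using Suc by simp
      qed
    qed simp
    have "(\<Sum>k<m. d k $ i) = (\<Sum>k<m. d m $ i)"
    proof (rule sum.cong)
      fix k assume "k \<in> {..<m}"
      then show "d k $ i = d m $ i"
        using const_up_to[of "m - k"] by simp
    qed simp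
    moreover have "(\<Sum>k<m. d k $ i) = p 0 $ i - p m $ i"
      unfolding d_def vector_minus_component by (rule sum_lessThan_telescope')
    ultimately have "real m * d m $ i = p 0 $ i - p m $ i"
      by simp
    then have "real m * c = \<bar>p 0 $ i - p m $ i\<bar>"
      by (metis abs_mult abs_of_nat i)
    also have "\<dots> \<le> \<bar>p 0 $ i\<bar> + \<bar>p m $ i\<bar>"
      by simp
    also have "\<dots> \<le> 2 * infnorm a"
      using p_bound[of 0] p_bound[of m] component_le_infnorm_cart[of "p 0" i]
        component_le_infnorm_cart[of "p m" i] by linarith
    finally show ?thesis .
  qed
  then have "c \<le> 0"
    by (meson not_le reals_Archimedean3)
  then have "infnorm (a - lazy A *v a) = 0"
    using const[of 0] infnorm_pos_le[of "a - lazy A *v a"] by simp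
  then show ?thesis
    by (simp add: infnorm_eq_0)
qed

text \<open>Any limit point \<open>z\<close> of an orbit has increments of constant norm, hence is fixed; and the
  distance of the orbit to a fixed point never increases.\<close>

lemma convergent_matrix_pow_lazy: "convergent (matrix_pow (lazy A))"
proof (rule convergent_matrix_if_mult_vector)
  fix v
  define p where "p m = matrix_pow (lazy A) m *v v" for m
  have p_Suc: "p (Suc m) = lazy A *v p m" for m
    by (simp add: p_def matrix_vector_mul_assoc)
  have p_add: "p (n + m) = matrix_pow (lazy A) m *v p n" for m n
    by (induction m) (simp_all add: p_Suc matrix_vector_mul_assoc)
  have "infnorm (p m) \<le> infnorm v" for m
  proof (induction m)
    case (Suc m)
    then show ?case
      using infnorm_lazy_le[of "p m"] by (simp add: p_Suc)
  qed (simp add: p_def)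
  then have "norm (p m) \<le> sqrt DIM(real^'n) * infnorm v" for m
    by (meson norm_le_infnorm mult_left_mono order_trans real_sqrt_ge_zero of_nat_0_le_iff)
  then have "bounded (range p)"
    by (auto simp: bounded_iff)
  then obtain z r where r: "strict_mono r" and z: "(p \<circ> r) \<longlonglongrightarrow> z"
    using bounded_imp_convergent_subsequence by blast
  define d where "d m = infnorm (p m - p (Suc m))" for m
  have "d (Suc m) \<le> d m" for m
    using infnorm_lazy_le[of "p m - p (Suc m)"]
    by (simp add: d_def p_Suc matrix_vector_mult_diff_distrib)
  then have "decseq d"
    by (rule decseq_SucI)
  moreover have "0 \<le> d m" for m
    by (simp add: d_def infnorm_pos_le)
  ultimately obtain c where c: "d \<longlonglongrightarrow> c"
    using decseq_convergent by blast
  \<comment> \<open>For fixed \<open>m\<close>, the numbers \<open>d (r n + m)\<close> tend to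
    \<open>c\<close> as a subsequence of a shift of \<open>d\<close>, and by continuity to the norm
    of the \<open>m\<close>-th increment in the orbit of \<open>z\<close>.\<close>
  have "infnorm (matrix_pow (lazy A) m *v (z - lazy A *v z)) = c" for m
  proof (rule LIMSEQ_unique)
    have "(\<lambda>n. infnorm (matrix_pow (lazy A) m *v (p (r n) - lazy A *v p (r n))))
        \<longlonglongrightarrow> infnorm (matrix_pow (lazy A) m *v (z - lazy A *v z))"
      using z unfolding comp_def
      by (intro tendsto_infnorm bounded_linear.tendsto[OF matrix_vector_mul_bounded_linear]
          tendsto_diff)
    moreover have "d (r n + m) = infnorm (matrix_pow (lazy A) m *v (p (r n) - lazy A *v p (r n)))" for n
      unfolding d_def p_Suc p_add
      by (simp add: matrix_vector_mult_diff_distrib matrix_vector_mul_assoc matrix_pow_commute)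
    ultimately show "(\<lambda>n. d (r n + m)) \<longlonglongrightarrow> infnorm (matrix_pow (lazy A) m *v (z - lazy A *v z))"
      by simp
    show "(\<lambda>n. d (r n + m)) \<longlonglongrightarrow> c"
      using LIMSEQ_subseq_LIMSEQ[OF LIMSEQ_ignore_initial_segment[OF c, of m] r] by (simp add: comp_def)
  qed
  then have fixed: "lazy A *v z = z"
    by (rule lazy_fixed_if_infnorm_increment_const)
  have "infnorm (p (Suc m) - z) \<le> infnorm (p m - z)" for m
    using infnorm_lazy_le[of "p m - z"] by (simp add: p_Suc matrix_vector_mult_diff_distrib fixed)
  then have "decseq (\<lambda>m. infnorm (p m - z))"
    by (rule decseq_SucI)
  then obtain e where e: "(\<lambda>m. infnorm (p m - z)) \<longlonglongrightarrow> e"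
    using decseq_convergent infnorm_pos_le by blast
  have "(\<lambda>n. infnorm (p (r n) - z)) \<longlonglongrightarrow> infnorm (z - z)"
    using z unfolding comp_def by (intro tendsto_intros)
  with LIMSEQ_subseq_LIMSEQ[OF e r] have "e = 0"
    using LIMSEQ_unique by (fastforce simp: comp_def infnorm_0)
  with e have "(\<lambda>m. sqrt DIM(real^'n) * infnorm (p m - z)) \<longlonglongrightarrow> 0"
    using tendsto_mult_right_zero by blast
  then have "(\<lambda>m. p m - z) \<longlonglongrightarrow> 0"
    by (rule Lim_null_comparison[rotated]) (simp add: norm_le_infnorm del: DIM_cart)
  then show "convergent (\<lambda>n. matrix_pow (lazy A) n *v v)"
    by (auto simp: p_def convergent_def LIM_zero_iff)
qed

end

section \<open>Transposition, conjugation and the limit of the powers\<close>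

lemma convergent_matrix_pow_transpose:
  assumes "convergent (matrix_pow A)"
  shows "convergent (matrix_pow (transpose A))"
  using assms tendsto_transpose unfolding convergent_def transpose_matrix_pow[symmetric] by blast

text \<open>Here \<open>B = T ** A ** S\<close>, and the inner factors cancel in its powers. This
  serves both the CDD case and the passage to the symmetric matrix.\<close>

lemma convergent_matrix_pow_conjugate:
  assumes "convergent (matrix_pow A)" "A ** S = S ** B" "T ** S = mat 1"
  shows "convergent (matrix_pow B)"
proof -
  have "matrix_pow B n = T ** (matrix_pow A n ** S)" for n
    by (simp add: matrix_pow_intertwine[OF assms(2)] matrix_mul_assoc assms(3))
  then have "matrix_pow B = (\<lambda>n. T ** (matrix_pow A n ** S))"
    by (rule ext)
  moreover obtain L where "matrix_pow A \<longlonglongrightarrow> L"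
    using assms(1) by (auto simp: convergent_def)
  then have "(\<lambda>n. T ** (matrix_pow A n ** S)) \<longlonglongrightarrow> T ** (L ** S)"
    by (intro tendsto_matrix_mult tendsto_const)
  ultimately show ?thesis
    by (auto simp: convergent_def)
qed

text \<open>Together the two facts make \<open>L\<close> a projection onto the fixed space of
  \<open>A\<close>: its range lies there, and it is the identity there.\<close>

lemma lim_matrix_pow:
  assumes "matrix_pow A \<longlonglongrightarrow> L"
  shows "A ** L = L" and "A *v x = x \<Longrightarrow> L *v x = x"
proof -
  have "(\<lambda>n. matrix_pow A (Suc n)) \<longlonglongrightarrow> A ** L"
    using assms by (simp add: tendsto_matrix_mult)
  then show "A ** L = L"
    using LIMSEQ_Suc[OF assms] LIMSEQ_unique by blast
  assume "A *v x = x"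
  then have "(\<lambda>n. matrix_pow A n *v x) = (\<lambda>n. x)"
    by (simp add: matrix_pow_fixed)
  then show "L *v x = x"
    using tendsto_matrix_vector_mult[OF assms, of x] by (simp add: LIMSEQ_const_iff)
qed

lemma lazy_fixed_iff: "lazy A *v x = x \<longleftrightarrow> A *v x = x"
proof -
  have "lazy A *v x - x = (1/2) *\<^sub>R (A *v x - x)"
    by (simp add: lazy_mult_vector vec_eq_iff)
  then show ?thesis
    by (metis eq_iff_diff_eq_0 scaleR_eq_0_iff zero_neq_numeral divide_eq_0_iff one_neq_zero)
qed

section \<open>The pseudoinverse from the projection onto the kernel\<close>

lemma matrix_diff_distribs:
  fixes A B :: "real^'m^'n" and C :: "real^'k^'m" and E :: "real^'n^'k"
  shows "(A - B) ** C = A ** C - B ** C" and "E ** (A - B) = E ** A - E ** B"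
    and "(A + B) ** C = A ** C + B ** C"
  by (simp_all add: matrix_matrix_mult_def vec_eq_iff algebra_simps sum_subtractf sum.distrib)

text \<open>The limit \<open>E\<close> is the orthogonal projection onto the kernel of \<open>N = 1 - K\<close>, so that \<open>N + E\<close> is
  invertible and the pseudoinverse of \<open>N\<close> is its inverse minus \<open>E\<close>.\<close>

lemma pseudoinverse_mult_symmetric:
  fixes K :: "real^'n^'n"
  assumes sym: "transpose K = K" and lim: "matrix_pow (lazy K) \<longlonglongrightarrow> E"
  shows "pseudoinverse (mat 1 - K) ** (mat 1 - K) = mat 1 - E"
proof -
  define N where "N = mat 1 - K"
  have symN: "transpose N = N"
    using sym by (simp add: N_def transpose_def mat_def vec_eq_iff)
  have symE: "transpose E = E"
    using tendsto_transpose[OF lim] lim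
    by (auto simp: transpose_matrix_pow transpose_lazy sym intro: LIMSEQ_unique)
  have "lazy K *v (E *v x) = E *v x" for x
    using lim_matrix_pow(1)[OF lim] by (simp add: matrix_vector_mul_assoc)
  then have KE: "K *v (E *v x) = E *v x" and EE: "E *v (E *v x) = E *v x" for x
    using lim_matrix_pow(2)[OF lim] by (auto simp: lazy_fixed_iff)
  have EE: "E ** E = E"
    using EE by (simp add: matrix_eq matrix_vector_mul_assoc[symmetric])
  have NE: "N ** E = 0"
    using KE by (simp add: N_def matrix_eq matrix_vector_mul_assoc[symmetric] algebra_simps)
  have EN: "E ** N = 0"
  proof -
    have "E ** N = transpose (N ** E)"
      by (simp add: matrix_transpose_mul symN symE)
    then show ?thesis
      by (simp add: NE transpose_def vec_eq_iff)
  qed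
  \<comment> \<open>Applying \<open>E\<close> removes the \<open>N\<close> term and leaves
    \<open>E *v x = 0\<close>. Then \<open>N *v x = 0\<close>, so \<open>x\<close> is fixed by
    \<open>K\<close> and therefore by \<open>E\<close>.\<close>
  have "x = 0" if x: "(N + E) *v x = 0" for x
  proof -
    have "E *v ((N + E) *v x) = E *v x"
      by (simp add: matrix_vector_mul_assoc matrix_add_ldistrib EN EE)
    with x have "E *v x = 0"
      by simp
    moreover from this x have "K *v x = x"
      by (simp add: N_def algebra_simps)
    then have "E *v x = x"
      using lim_matrix_pow(2)[OF lim] by (simp add: lazy_fixed_iff)
    ultimately show ?thesis
      by simp
  qed
  then obtain Y where Y: "Y ** (N + E) = mat 1"
    using matrix_left_invertible_ker by blast
  then have Y': "(N + E) ** Y = mat 1"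
    by (simp add: matrix_left_right_inverse)
  \<comment> \<open>Both \<open>(N + E) ** E\<close> and \<open>E ** (N + E)\<close> equal
    \<open>E\<close>, so cancelling \<open>N + E\<close> shows that \<open>Y\<close> acts trivially
    on \<open>E\<close> from either side.\<close>
  have "Y ** ((N + E) ** E) = E" "(E ** (N + E)) ** Y = E"
    by (simp_all only: matrix_mul_assoc Y, simp_all add: matrix_mul_assoc[symmetric] Y')
  then have YE: "Y ** E = E" and EY: "E ** Y = E"
    by (simp_all add: matrix_diff_distribs matrix_add_ldistrib NE EN EE)
  define X where "X = Y - E"
  have XN: "X ** N = mat 1 - E"
    using Y by (simp add: X_def matrix_diff_distribs matrix_add_ldistrib EN YE eq_diff_eq)
  have NX: "N ** X = mat 1 - E"
    using Y' by (simp add: X_def matrix_diff_distribs NE EY eq_diff_eq)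
  \<comment> \<open>Yields the second Penrose condition:
    \<open>X ** N ** X = (mat 1 - E) ** X = X\<close>.\<close>
  have "E ** X = 0"
    by (simp add: X_def matrix_diff_distribs EY EE)
  moreover have "transpose (mat 1 - E) = mat 1 - E"
    using symE by (simp add: transpose_def mat_def vec_eq_iff)
  ultimately have "is_pseudoinverse N X"
    by (simp add: is_pseudoinverse_def XN NX matrix_diff_distribs EN)
  then have "pseudoinverse N = X"
    unfolding pseudoinverse_def by (blast intro: is_pseudoinverse_unique)
  then show ?thesis
    using XN by (simp add: N_def)
qed

section \<open>Diagonal matrices and the Jacobi matrix\<close>

definition diagonal :: "('n \<Rightarrow> real) \<Rightarrow> real^'n^'n" where
  "diagonal d = (\<chi> i j. if i = j then d i else 0)"

lemma diagonal_mult_nth: "(diagonal d ** A) $ i $ j = d i * A $ i $ j"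
  by (simp add: matrix_matrix_mult_def diagonal_def if_distrib[of "\<lambda>x. x * _"] cong: if_cong)

lemma mult_diagonal_nth: "(A ** diagonal d) $ i $ j = A $ i $ j * d j"
  by (simp add: matrix_matrix_mult_def diagonal_def if_distrib[of "(*) _"] cong: if_cong)

lemma diagonal_inverse:
  assumes "\<And>i. d i * e i = 1"
  shows "diagonal d ** diagonal e = mat 1"
  by (simp add: vec_eq_iff diagonal_mult_nth) (simp add: diagonal_def mat_def assms)

lemma diag_part_eq_diagonal: "diag_part M = diagonal (\<lambda>i. M $ i $ i)"
  by (simp add: diag_part_def diagonal_def)

lemma diag_inv_sqrt_eq_diagonal:
  "diag_inv_sqrt (diag_part M) = diagonal (\<lambda>i. 1 / sqrt (M $ i $ i))"
  by (simp add: diag_inv_sqrt_def diag_part_def diagonal_def vec_eq_iff)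

lemma matrix_inv_eqI:
  assumes "A ** B = mat 1" "B ** A = mat 1"
  shows "matrix_inv A = B"
  unfolding matrix_inv_def
proof (rule some_equality)
  fix C assume "A ** C = mat 1 \<and> C ** A = mat 1"
  then show "C = B"
    by (metis assms(1) matrix_mul_assoc matrix_mul_lid matrix_mul_rid)
qed (use assms in simp)

lemma matrix_inv_diag_part:
  assumes "\<And>i. M $ i $ i > 0"
  shows "matrix_inv (diag_part M) = diagonal (\<lambda>i. 1 / M $ i $ i)"
  unfolding diag_part_eq_diagonal
  by (rule matrix_inv_eqI; rule diagonal_inverse) (use assms in \<open>simp_all add: less_imp_neq[symmetric]\<close>)

text \<open>The iteration matrix of Jacobi's method for a linear system with matrix
  \<open>M\<close>.\<close>

definition jacobi :: "real^'n^'n \<Rightarrow> real^'n^'n" where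
  "jacobi M = matrix_inv (diag_part M) ** transpose (adj_part M)"

lemma jacobi_nth:
  assumes "\<And>i. M $ i $ i > 0"
  shows "jacobi M $ i $ j = (if i = j then 0 else - (M $ i $ j / M $ i $ i))"
  unfolding jacobi_def matrix_inv_diag_part[OF assms] diagonal_mult_nth
  by (simp add: adj_part_def diag_part_def)

lemma inverse_diag_mult_eq:
  assumes "\<And>i. M $ i $ i > 0"
  shows "matrix_inv (diag_part M) ** M = mat 1 - jacobi M"
  using assms
  by (simp add: vec_eq_iff matrix_inv_diag_part diagonal_mult_nth jacobi_nth mat_def less_imp_neq[symmetric])

lemma xstar_term_eq:
  "xstar_term M b l = matrix_pow (lazy (jacobi M)) l *v (matrix_inv (diag_part M) *v b)"
  by (simp add: xstar_term_def lazy_def jacobi_def)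

text \<open>This is diagonal dominance of row \<open>i\<close> divided by
  \<open>M $ i $ i\<close>.\<close>

lemma RDD_jacobi_row_sum:
  assumes "RDD M"
  shows "(\<Sum>j\<in>UNIV. \<bar>jacobi M $ i $ j\<bar>) \<le> 1"
proof -
  have pos: "\<And>i. M $ i $ i > 0"
    using assms by (simp add: RDD_def)
  have "(\<Sum>j\<in>UNIV. \<bar>jacobi M $ i $ j\<bar>) = (\<Sum>j\<in>UNIV - {i}. \<bar>M $ i $ j\<bar> / M $ i $ i)"
    by (rule sum.mono_neutral_cong_right) (use pos in \<open>auto simp: jacobi_nth abs_of_pos\<close>)
  also have "\<dots> \<le> 1"
    using assms pos[of i] by (simp add: RDD_def sum_divide_distrib[symmetric])
  finally show ?thesis .
qed

lemma convergent_matrix_pow_lazy_jacobi: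
  assumes "RDD M \<or> CDD M"
  shows "convergent (matrix_pow (lazy (jacobi M)))"
  using assms
proof
  assume "RDD M"
  then show ?thesis
    by (intro convergent_matrix_pow_lazy RDD_jacobi_row_sum)
next
  assume "CDD M"
  then have rdd: "RDD (transpose M)"
    by (simp add: CDD_def)
  then have pos: "M $ i $ i > 0" "transpose M $ i $ i > 0" for i
    by (simp_all add: RDD_def transpose_def)
  \<comment> \<open>In the notation of the introduction, \<open>?Q\<close> is
    \<open>A\<^sup>T D\<^sup>-\<^sup>1\<close>, and \<open>D\<close> conjugates it to
    \<open>D\<^sup>-\<^sup>1 A\<^sup>T\<close>.\<close>
  let ?Q = "transpose (jacobi (transpose M))"
  have "convergent (matrix_pow (lazy ?Q))"
    unfolding transpose_lazy[symmetric]
    by (intro convergent_matrix_pow_transpose convergent_matrix_pow_lazy RDD_jacobi_row_sum rdd)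
  moreover have "?Q ** diag_part M = diag_part M ** jacobi M"
  proof -
    have "?Q $ i $ j = (if i = j then 0 else - (M $ i $ j / M $ j $ j))" for i j
      using jacobi_nth[OF pos(2), of j i] by (simp add: transpose_def)
    then show ?thesis
      using pos(1) by (simp add: vec_eq_iff diag_part_eq_diagonal diagonal_mult_nth mult_diagonal_nth
          jacobi_nth less_imp_neq[symmetric])
  qed
  moreover have "diagonal (\<lambda>i. 1 / M $ i $ i) ** diag_part M = mat 1"
    unfolding diag_part_eq_diagonal
    by (rule diagonal_inverse) (use pos in \<open>simp add: less_imp_neq[symmetric]\<close>)
  ultimately show ?thesis
    using convergent_matrix_pow_conjugate lazy_intertwine by blast
qed

section \<open>Symmetric normalization\<close>

lemma normalized_symmetric:
  assumes "transpose M = M"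
  shows "transpose (normalized M) = normalized M"
proof -
  have "M $ i $ j = M $ j $ i" for i j
    using arg_cong[OF assms, of "\<lambda>A. A $ j $ i"] by (simp add: transpose_def)
  then show ?thesis
    by (simp add: normalized_def diag_inv_sqrt_eq_diagonal vec_eq_iff mult_diagonal_nth
        diagonal_mult_nth transpose_def)
qed

text \<open>With \<open>S = D\<^sup>-\<^sup>1\<^sup>/\<^sup>2\<close> one has
  \<open>S S = D\<^sup>-\<^sup>1\<close>, hence
  \<open>D\<^sup>-\<^sup>1 M S = S (S M S)\<close>.\<close>

lemma jacobi_intertwine_normalized:
  assumes pos: "\<And>i. M $ i $ i > 0"
  shows "jacobi M ** diag_inv_sqrt (diag_part M) =
    diag_inv_sqrt (diag_part M) ** (mat 1 - normalized M)"
proof -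
  have "sqrt (M $ i $ i) * sqrt (M $ i $ i) = M $ i $ i" for i
    using pos[of i] by simp
  then show ?thesis
    using pos
    by (simp add: normalized_def diag_inv_sqrt_eq_diagonal vec_eq_iff mult_diagonal_nth
        diagonal_mult_nth jacobi_nth mat_def less_imp_neq[symmetric])
qed

section \<open>Evaluation of the series\<close>

theorem theorem1p1:
  fixes M :: "real^'n^'n" and b :: "real^'n"
  assumes "RDD M \<or> CDD M"
    and "b \<in> range ((*v) M)"
  shows "summable (xstar_term M b) \<and> M *v xstar M b = b \<and>
    (SDD M \<longrightarrow>
      xstar M b =
        (diag_inv_sqrt (diag_part M) ** pseudoinverse (normalized M)
          ** diag_inv_sqrt (diag_part M)) *v b)"
proof -
  have pos: "M $ i $ i > 0" for i
    using assms(1) by (auto simp: RDD_def CDD_def transpose_def)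
  obtain y where y: "b = M *v y"
    using assms(2) by blast
  obtain L where L: "matrix_pow (lazy (jacobi M)) \<longlonglongrightarrow> L"
    using convergent_matrix_pow_lazy_jacobi[OF assms(1)] by (auto simp: convergent_def)
  let ?p = "\<lambda>n. matrix_pow (lazy (jacobi M)) n *v y"
  have "matrix_inv (diag_part M) *v b = y - jacobi M *v y"
    by (simp add: y matrix_vector_mul_assoc inverse_diag_mult_eq[OF pos] algebra_simps)
  also have "\<dots> = 2 *\<^sub>R (y - lazy (jacobi M) *v y)"
    by (simp add: lazy_mult_vector vec_eq_iff field_simps)
  \<comment> \<open>The factor 2 cancels the 1/2 in \<open>xstar\<close>.\<close>
  finally have "xstar_term M b n = 2 *\<^sub>R (?p n - ?p (Suc n))" for n
    by (simp add: xstar_term_eq matrix_vector_mult_scaleR matrix_vector_mult_diff_distrib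
        matrix_vector_mul_assoc matrix_pow_commute)
  then have "xstar_term M b = (\<lambda>n. 2 *\<^sub>R (?p n - ?p (Suc n)))"
    by (rule ext)
  moreover have "(\<lambda>n. 2 *\<^sub>R (?p n - ?p (Suc n))) sums (2 *\<^sub>R (?p 0 - L *v y))"
    by (intro sums_scaleR_right telescope_sums' tendsto_matrix_vector_mult L)
  ultimately have sums: "xstar_term M b sums (2 *\<^sub>R (y - L *v y))"
    by simp
  then have xstar: "xstar M b = y - L *v y"
    by (simp add: xstar_def sums_unique[symmetric])
  have "lazy (jacobi M) *v (L *v y) = L *v y"
    using lim_matrix_pow(1)[OF L] by (simp add: matrix_vector_mul_assoc)
  \<comment> \<open>A vector fixed by the averaged matrix is fixed by \<open>jacobi M\<close>, and
    \<open>mat 1 - jacobi M\<close> is the inverse of the diagonal part times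
    \<open>M\<close>.\<close>
  then have "matrix_inv (diag_part M) *v (M *v (L *v y)) = 0"
    by (simp add: matrix_vector_mul_assoc[of _ M] inverse_diag_mult_eq[OF pos] lazy_fixed_iff
        algebra_simps)
  moreover have "diag_part M ** matrix_inv (diag_part M) = mat 1"
    unfolding matrix_inv_diag_part[OF pos] unfolding diag_part_eq_diagonal
    by (rule diagonal_inverse) (use pos in \<open>simp add: less_imp_neq[symmetric]\<close>)
  ultimately have "M *v (L *v y) = 0"
    by (metis matrix_vector_mul_assoc matrix_vector_mul_lid matrix_vector_mult_0_right)
  then have solves: "M *v xstar M b = b"
    unfolding xstar by (simp add: y matrix_vector_mult_diff_distrib)
  let ?S = "diag_inv_sqrt (diag_part M)"
  have "xstar M b = (?S ** pseudoinverse (normalized M) ** ?S) *v b" if "SDD M"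
  proof -
    define K where "K = mat 1 - normalized M"
    have N: "mat 1 - K = normalized M"
      by (simp add: K_def)
    have symK: "transpose K = K"
      using normalized_symmetric that
      by (fastforce simp: SDD_def K_def transpose_def mat_def vec_eq_iff)
    have JS: "lazy (jacobi M) ** ?S = ?S ** lazy K"
      unfolding K_def by (intro lazy_intertwine jacobi_intertwine_normalized pos)
    let ?T = "diagonal (\<lambda>i. sqrt (M $ i $ i))"
    have TS: "?T ** ?S = mat 1" and ST: "?S ** ?T = mat 1"
      unfolding diag_inv_sqrt_eq_diagonal
      by (rule diagonal_inverse; use pos in \<open>simp add: less_imp_neq[symmetric]\<close>)+
    \<comment> \<open>The row sums of \<open>K\<close> may exceed 1, so convergence is transported
      from \<open>jacobi M\<close> by similarity.\<close>
    obtain E where E: "matrix_pow (lazy K) \<longlonglongrightarrow> E"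
      using convergent_matrix_pow_conjugate[OF _ JS TS] L by (auto simp: convergent_def)
    have "(\<lambda>n. matrix_pow (lazy (jacobi M)) n ** ?S) \<longlonglongrightarrow> L ** ?S"
      by (intro tendsto_matrix_mult L tendsto_const)
    moreover have "(\<lambda>n. ?S ** matrix_pow (lazy K) n) \<longlonglongrightarrow> ?S ** E"
      by (intro tendsto_matrix_mult E tendsto_const)
    ultimately have LS: "L ** ?S = ?S ** E"
      using LIMSEQ_unique by (simp add: matrix_pow_intertwine[OF JS])
    \<comment> \<open>The vector \<open>y\<close> in the coordinates of the normalized matrix. Since
      \<open>b = M *v y\<close>, the pseudoinverse then meets only a vector in the range of
      \<open>normalized M\<close>, and its product with that matrix is known.\<close>
    define u where "u = ?T *v y"
    have yu: "y = ?S *v u"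
      by (simp add: u_def matrix_vector_mul_assoc ST)
    have "?S *v b = normalized M *v u"
      by (simp add: y yu normalized_def matrix_vector_mul_assoc matrix_mul_assoc)
    then have "(?S ** pseudoinverse (normalized M) ** ?S) *v b
        = ?S *v ((pseudoinverse (normalized M) ** normalized M) *v u)"
      by (simp add: matrix_vector_mul_assoc[symmetric])
    also have "\<dots> = ?S *v (u - E *v u)"
      using pseudoinverse_mult_symmetric[OF symK E] by (simp add: N matrix_vector_mult_diff_rdistrib)
    also have "\<dots> = y - L *v y"
      by (simp add: yu matrix_vector_mult_diff_distrib matrix_vector_mul_assoc LS)
    finally show ?thesis
      by (simp add: xstar)
  qed
  then show ?thesis
    using sums solves by (simp add: sums_iff)
qed

end
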